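(* For every $n\geq 5$ and every $n$-dimensional restricted HL-graph $G^n\in RHL_n$, $fsmp(G^n)=fmp(G^n)=n$.
   Context: For graphs $G_0,G_1$ with $|V(G_0)|=|V(G_1)|$ and a bijection $\phi:V(G_0)\to V(G_1)$, $G_0\oplus_\phi G_1$ is the graph with vertex set $V(G_0)\cup V(G_1)$ (disjoint) and edge set $E(G_0)\cup E(G_1)\cup\{v\phi(v):v\in V(G_0)\}$. Let $G(8,4)$ be the graph with vertex set $\{0,\dots,7\}$ in which $u,v$ are adjacent iff $u-v\equiv \pm1$ or $4 \pmod 8$. Define $RHL_0=\{K_1\}$, $RHL_1=\{K_2\}$, $RHL_2=\{C_4\}$, $RHL_3=\{G(8,4)\}$ and, for $n\geq 4$, $RHL_n=\{G_0\oplus_\phi G_1: G_0,G_1\in RHL_{n-1},\ \phi \text{ a bijection } V(G_0)\to V(G_1)\}$. A fractional perfect matching of $G$ is $g:E(G)\to[0,1]$ with $\sum_{e\ni v}g(e)=1$ for all $v$. $fmp(G)$ (resp. $fsmp(G)$) is the minimum size of a set $F\subseteq E(G)$ (resp. $F\subseteq V(G)\cup E(G)$) whose deletion (vertices with incident edges, and edges) leaves a graph with no fractional perfect matching. *)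

theory Defs
  imports Complex_Main "HOL-Number_Theory.Cong"
begin

datatype 'a graph = Graph (verts: "'a set") (edges: "'a set set")

definition simple_graph :: "'a graph \<Rightarrow> bool" where
  "simple_graph G \<longleftrightarrow> finite (verts G) \<and> (\<forall>e\<in>edges G. e \<subseteq> verts G \<and> card e = 2)"

definition isomorphic :: "'a graph \<Rightarrow> 'b graph \<Rightarrow> bool" where
  "isomorphic G H \<longleftrightarrow> simple_graph G \<and> simple_graph H \<and>
     (\<exists>f. bij_betw f (verts G) (verts H) \<and> edges H = (\<lambda>e. f ` e) ` edges G)"

definition complete_graph :: "nat \<Rightarrow> nat graph" where
  "complete_graph n = Graph {..<n} {{u, v} | u v. u < n \<and> v < n \<and> u \<noteq> v}"

definition C4 :: "nat graph" where
  "C4 = Graph {0, 1, 2, 3} {{0, 1}, {1, 2}, {2, 3}, {3, 0}}"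

definition G84 :: "int graph" where
  "G84 = Graph {0..7} {{u, v} | u v. u \<in> {0..7} \<and> v \<in> {0..7} \<and>
     ([u - v = 1] (mod 8) \<or> [u - v = - 1] (mod 8) \<or> [u - v = 4] (mod 8))}"

text \<open>The disjointness of the two vertex sets is imposed where this operation is used.\<close>

definition oplus :: "('a \<Rightarrow> 'a) \<Rightarrow> 'a graph \<Rightarrow> 'a graph \<Rightarrow> 'a graph" where
  "oplus \<phi> G0 G1 = Graph (verts G0 \<union> verts G1)
     (edges G0 \<union> edges G1 \<union> {{v, \<phi> v} | v. v \<in> verts G0})"

text \<open>Graphs are taken up to isomorphism: \<open>RHL n G\<close> holds for every graph \<open>G\<close> over the
  vertex type \<open>'a\<close> that is a copy of a member of the family. In particular \<open>G0\<close> and \<open>G1\<close>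
  below may be disjoint copies of the same graph.\<close>

inductive RHL :: "nat \<Rightarrow> 'a graph \<Rightarrow> bool" where
  RHL_0: "isomorphic (complete_graph 1) G \<Longrightarrow> RHL 0 G"
| RHL_1: "isomorphic (complete_graph 2) G \<Longrightarrow> RHL 1 G"
| RHL_2: "isomorphic C4 G \<Longrightarrow> RHL 2 G"
| RHL_3: "isomorphic G84 G \<Longrightarrow> RHL 3 G"
| RHL_oplus: "n \<ge> 4 \<Longrightarrow> RHL (n - 1) G0 \<Longrightarrow> RHL (n - 1) G1 \<Longrightarrow> verts G0 \<inter> verts G1 = {} \<Longrightarrow>
    bij_betw \<phi> (verts G0) (verts G1) \<Longrightarrow> RHL n (oplus \<phi> G0 G1)"

definition fractional_perfect_matching :: "'a graph \<Rightarrow> ('a set \<Rightarrow> real) \<Rightarrow> bool" where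
  "fractional_perfect_matching G g \<longleftrightarrow> (\<forall>e\<in>edges G. 0 \<le> g e \<and> g e \<le> 1) \<and>
     (\<forall>v\<in>verts G. (\<Sum>e\<in>{e \<in> edges G. v \<in> e}. g e) = 1)"

definition delete :: "'a graph \<Rightarrow> 'a set \<Rightarrow> 'a set set \<Rightarrow> 'a graph" where
  "delete G U D = Graph (verts G - U) {e \<in> edges G - D. e \<inter> U = {}}"

text \<open>The two minima are meant for finite graphs with at least one vertex, where some
  deletion destroys all fractional perfect matchings; otherwise \<open>LEAST\<close> may be unspecified.\<close>

definition fmp :: "'a graph \<Rightarrow> nat" where
  "fmp G = (LEAST k. \<exists>F. F \<subseteq> edges G \<and> finite F \<and> card F = k \<and>
     (\<nexists>g. fractional_perfect_matching (delete G {} F) g))"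

text \<open>A set of vertices and edges is a subset of the disjoint sum of the two sets.\<close>

definition fsmp :: "'a graph \<Rightarrow> nat" where
  "fsmp G = (LEAST k. \<exists>F. F \<subseteq> verts G <+> edges G \<and> finite F \<and> card F = k \<and>
     (\<nexists>g. fractional_perfect_matching (delete G {v. Inl v \<in> F} {e. Inr e \<in> F}) g))"

end

theory Submission
  imports Defs "HOL-Library.Indicator_Function"
begin

text \<open>
  Fractional perfect matchings are handled through the convex cone spanned by the indicator
  functions of the edges: deleting \<open>U\<close> and \<open>D\<close> leaves one iff the indicator of \<open>V - U\<close> lies in
  the cone of \<open>E - D\<close>. The upper bound holds since an \<open>n\<close>-dimensional graph is \<open>n\<close>-regular. For
  the lower bound, by induction, fewer than \<open>n\<close> deletions are harmless if each half of
  \<open>G0 \<oplus> G1\<close> copes with its own share. Otherwise almost all deletions lie in one half, say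
  \<open>G0\<close>. Restore one deleted vertex or edge there and take a fractional perfect matching of the
  result; the vertices matched through the restored object lose some weight, which they recover
  from their partners in \<open>G1\<close>, because \<open>G1\<close> without one or two vertices still has a fractional
  perfect matching, and convex combinations of these provide the required weights.
\<close>


section \<open>The cone spanned by edge indicators\<close>

text \<open>Membership prescribes the weight at every element of the type, so demand 0 at a vertex
  forces weight 0 on all edges of \<open>E\<close> through it. Deleting vertices thus only changes
  the target function and not the edge set. No upper bound on \<open>g\<close> is imposed: for
  nonempty edges it follows once the demands are at most 1.\<close>

definition edge_cone :: "'a set set \<Rightarrow> ('a \<Rightarrow> real) set" where
  "edge_cone E = {d. \<exists>g. (\<forall>e\<in>E. 0 \<le> g e) \<and> (\<forall>v. d v = (\<Sum>e\<in>E. g e * indicator e v))}"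

lemma edge_coneI:
  assumes "\<And>e. e \<in> E \<Longrightarrow> 0 \<le> g e" "\<And>v. d v = (\<Sum>e\<in>E. g e * indicator e v)"
  shows "d \<in> edge_cone E"
  using assms unfolding edge_cone_def by blast

lemma edge_coneE:
  assumes "d \<in> edge_cone E"
  obtains g where "\<And>e. e \<in> E \<Longrightarrow> 0 \<le> g e" "\<And>v. d v = (\<Sum>e\<in>E. g e * indicator e v)"
proof -
  from assms obtain g where "(\<forall>e\<in>E. 0 \<le> g e) \<and> (\<forall>v. d v = (\<Sum>e\<in>E. g e * indicator e v))"
    unfolding edge_cone_def by blast
  then show thesis using that[of g] by simp
qed

lemma edge_cone_mono:
  assumes "d \<in> edge_cone E" "E \<subseteq> E'" "finite E'"
  shows "d \<in> edge_cone E'"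
proof -
  obtain g where g: "\<And>e. e \<in> E \<Longrightarrow> 0 \<le> g e" "\<And>v. d v = (\<Sum>e\<in>E. g e * indicator e v)"
    using assms(1) by (rule edge_coneE) blast
  show ?thesis
  proof (rule edge_coneI[where g = "\<lambda>e. if e \<in> E then g e else 0"])
    fix v
    show "d v = (\<Sum>e\<in>E'. (if e \<in> E then g e else 0) * indicator e v)"
      unfolding g(2) using assms by (intro sum.mono_neutral_cong_left) auto
  qed (use g in auto)
qed

lemma edge_cone_add:
  assumes "d \<in> edge_cone E" "d' \<in> edge_cone E"
  shows "(\<lambda>v. d v + d' v) \<in> edge_cone E"
proof -
  obtain g where g: "\<And>e. e \<in> E \<Longrightarrow> 0 \<le> g e" "\<And>v. d v = (\<Sum>e\<in>E. g e * indicator e v)"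
    using assms(1) by (rule edge_coneE) blast
  obtain g' where g': "\<And>e. e \<in> E \<Longrightarrow> 0 \<le> g' e" "\<And>v. d' v = (\<Sum>e\<in>E. g' e * indicator e v)"
    using assms(2) by (rule edge_coneE) blast
  show ?thesis
    by (rule edge_coneI[where g = "\<lambda>e. g e + g' e"])
      (use g g' in \<open>auto simp: sum.distrib distrib_right\<close>)
qed

lemma edge_cone_scale:
  assumes "d \<in> edge_cone E" "0 \<le> c"
  shows "(\<lambda>v. c * d v) \<in> edge_cone E"
proof -
  obtain g where g: "\<And>e. e \<in> E \<Longrightarrow> 0 \<le> g e" "\<And>v. d v = (\<Sum>e\<in>E. g e * indicator e v)"
    using assms(1) by (rule edge_coneE) blast
  show ?thesis
    by (rule edge_coneI[where g = "\<lambda>e. c * g e"])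
      (use g assms in \<open>auto simp: sum_distrib_left mult.assoc\<close>)
qed

lemma zero_in_edge_cone: "(\<lambda>v. 0) \<in> edge_cone E"
  by (rule edge_coneI[where g = "\<lambda>_. 0"]) auto

lemma edge_cone_sum:
  assumes "finite I" "\<And>i. i \<in> I \<Longrightarrow> d i \<in> edge_cone E"
  shows "(\<lambda>v. \<Sum>i\<in>I. d i v) \<in> edge_cone E"
  using assms
proof (induction I rule: finite_induct)
  case (insert i I)
  then show ?case
    using edge_cone_add[of "d i" E "\<lambda>v. \<Sum>i\<in>I. d i v"] by auto
qed (simp add: zero_in_edge_cone)

lemma edge_in_edge_cone:
  assumes "finite E" "e \<in> E"
  shows "indicator e \<in> edge_cone E"
proof (rule edge_coneI[where g = "\<lambda>e'. if e' = e then 1 else 0"])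
  fix v
  have "(\<Sum>e'\<in>E. (if e' = e then 1 else 0) * indicator e' v) =
    (\<Sum>e'\<in>E. if e' = e then indicator e' v else (0::real))"
    by (intro sum.cong) auto
  then show "indicator e v = (\<Sum>e'\<in>E. (if e' = e then 1 else 0) * (indicator e' v :: real))"
    using assms by simp
qed auto

section \<open>Disjoint unions, and rerouting the weight of a lost edge or vertex\<close>

lemma indicator_disjoint_Un:
  assumes "A \<inter> B = {}"
  shows "indicator (A \<union> B) = (\<lambda>v. indicator A v + indicator B v :: real)"
  using assms by (intro ext) (auto simp: indicator_def)

lemma edge_cone_disjoint_Un:
  assumes "indicator A \<in> edge_cone E" "indicator B \<in> edge_cone E" "A \<inter> B = {}"
  shows "indicator (A \<union> B) \<in> edge_cone E"
  using edge_cone_add[OF assms(1,2)] by (simp add: indicator_disjoint_Un[OF assms(3)])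

text \<open>The weight of a lost edge e is shifted to a matching of the spare set B together with
  the ends of e.\<close>

lemma edge_cone_reroute_edge:
  assumes X: "indicator X \<in> edge_cone (insert e E)" and fin: "finite E" and "e \<noteq> {}"
    and B: "indicator B \<in> edge_cone E" and eB: "indicator (e \<union> B) \<in> edge_cone E"
    and disj: "X \<inter> B = {}" "e \<inter> B = {}"
  shows "indicator (X \<union> B) \<in> edge_cone E"
proof (cases "e \<in> E")
  case True
  then show ?thesis
    using edge_cone_disjoint_Un[OF _ B disj(1)] X by (simp add: insert_absorb)
next
  case False
  obtain g where g: "\<And>e'. e' \<in> insert e E \<Longrightarrow> 0 \<le> g e'"
    "\<And>v. (indicator X v :: real) = (\<Sum>e'\<in>insert e E. g e' * indicator e' v)"
    using X by (rule edge_coneE) blast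
  define r where "r = (\<lambda>v. \<Sum>e'\<in>E. g e' * indicator e' v)"
  have r: "r \<in> edge_cone E"
    by (rule edge_coneI[where g = g]) (use g in \<open>auto simp: r_def\<close>)
  have eq: "indicator X v = g e * indicator e v + r v" for v
    using g(2) fin False by (simp add: r_def)
  \<comment> \<open>At an end of \<open>e\<close> the demand is at most 1 and the other edges
    contribute \<open>r\<close>, which is nonnegative. The bound makes \<open>g e\<close> and
    \<open>1 - g e\<close> usable as convex coefficients.\<close>
  have "g e \<le> 1"
  proof -
    obtain v where "v \<in> e" using \<open>e \<noteq> {}\<close> by blast
    have "0 \<le> r v" unfolding r_def by (intro sum_nonneg mult_nonneg_nonneg) (use g in auto)
    then show ?thesis
      using eq[of v] \<open>v \<in> e\<close> by (cases "v \<in> X") auto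
  qed
  \<comment> \<open>\<open>B\<close> is covered with weight \<open>g e + (1 - g e) = 1\<close>,
    while the ends of \<open>e\<close> receive exactly the \<open>g e\<close> that they lost with
    \<open>e\<close>.\<close>
  have "(\<lambda>v. r v + (g e * indicator (e \<union> B) v + (1 - g e) * indicator B v)) \<in> edge_cone E"
    by (intro edge_cone_add[OF r] edge_cone_add[OF edge_cone_scale[OF eB] edge_cone_scale[OF B]])
      (use \<open>g e \<le> 1\<close> g in auto)
  also have "(\<lambda>v. r v + (g e * indicator (e \<union> B) v + (1 - g e) * indicator B v)) = indicator (X \<union> B)"
    by (auto simp: indicator_disjoint_Un[OF disj(1)] indicator_disjoint_Un[OF disj(2)] eq algebra_simps)
  finally show ?thesis .
qed

text \<open>The edges at \<open>v\<close> in the old matching have total weight 1. Replacing each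
  such \<open>e\<close> by the matching of \<open>e - {v} \<union> B\<close> supplied by
  \<open>near\<close>, with the same weight, returns to the rest of \<open>e\<close> what it loses
  with \<open>v\<close>. As these weights sum to 1, \<open>B\<close> is covered exactly
  once.\<close>

lemma edge_cone_reroute_vertex:
  assumes X: "indicator X \<in> edge_cone E0" and v: "v \<in> X" "v \<notin> B"
    and fin: "finite E0" "finite E"
    and avoid: "\<And>e. e \<in> E0 \<Longrightarrow> v \<notin> e \<Longrightarrow> e \<in> E"
    and near: "\<And>e. e \<in> E0 \<Longrightarrow> v \<in> e \<Longrightarrow> indicator (e - {v} \<union> B) \<in> edge_cone E"
    and disj: "X \<inter> B = {}" "\<And>e. e \<in> E0 \<Longrightarrow> e \<inter> B = {}"
  shows "indicator (X - {v} \<union> B) \<in> edge_cone E"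
proof -
  obtain g where g: "\<And>e'. e' \<in> E0 \<Longrightarrow> 0 \<le> g e'"
    "\<And>x. (indicator X x :: real) = (\<Sum>e'\<in>E0. g e' * indicator e' x)"
    using X by (rule edge_coneE) blast
  define S where "S = {e \<in> E0. v \<in> e}"
  define T where "T = {e \<in> E0. v \<notin> e}"
  have ST: "E0 = S \<union> T" "S \<inter> T = {}" "finite S" "finite T"
    using fin by (auto simp: S_def T_def)
  define r where "r = (\<lambda>x. \<Sum>e\<in>T. g e * indicator e x)"
  have "r \<in> edge_cone T"
    by (rule edge_coneI[where g = g]) (use g in \<open>auto simp: r_def T_def\<close>)
  then have r: "r \<in> edge_cone E"
    by (rule edge_cone_mono) (use fin avoid in \<open>auto simp: T_def\<close>)
  have eq: "indicator X x = (\<Sum>e\<in>S. g e * indicator e x) + r x" for x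
    using g(2)[of x] ST by (simp add: r_def sum.union_disjoint)
  have "r v = 0" unfolding r_def by (intro sum.neutral) (auto simp: T_def)
  \<comment> \<open>Only edges of \<open>S\<close> reach \<open>v\<close>, so their weights alone
    meet the demand 1 at \<open>v\<close>.\<close>
  then have sum1: "(\<Sum>e\<in>S. g e) = 1"
    using eq[of v] v by (simp add: S_def)
  have "(\<lambda>x. r x + (\<Sum>e\<in>S. g e * indicator (e - {v} \<union> B) x)) \<in> edge_cone E"
    by (intro edge_cone_add[OF r] edge_cone_sum[OF \<open>finite S\<close>] edge_cone_scale[OF near])
      (use g in \<open>auto simp: S_def\<close>)
  also have "(\<lambda>x. r x + (\<Sum>e\<in>S. g e * indicator (e - {v} \<union> B) x)) = indicator (X - {v} \<union> B)"
  proof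
    fix x
    have split: "indicator (e - {v} \<union> B) x = indicator (e - {v}) x + (indicator B x :: real)" if "e \<in> S" for e
      using disj(2)[of e] that by (auto simp: S_def indicator_def)
    have "(\<Sum>e\<in>S. g e * indicator (e - {v} \<union> B) x)
        = (\<Sum>e\<in>S. g e * indicator (e - {v}) x) + (\<Sum>e\<in>S. g e * indicator B x)"
      unfolding sum.distrib[symmetric] by (intro sum.cong refl) (simp add: split distrib_left)
    also have "(\<Sum>e\<in>S. g e * indicator B x) = indicator B x"
      using sum1 by (simp add: sum_distrib_right[symmetric])
    finally have 1: "(\<Sum>e\<in>S. g e * indicator (e - {v} \<union> B) x)
        = (\<Sum>e\<in>S. g e * indicator (e - {v}) x) + indicator B x" .
    have 2: "r x + (\<Sum>e\<in>S. g e * indicator (e - {v}) x) = indicator (X - {v}) x"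
    proof (cases "x = v")
      case False
      then have "indicator (e - {v}) x = (indicator e x :: real)" for e
        by (auto simp: indicator_def)
      then show ?thesis using eq[of x] by simp
    qed (use \<open>r v = 0\<close> in simp)
    have 3: "indicator (X - {v} \<union> B) x = indicator (X - {v}) x + (indicator B x :: real)"
      using disj(1) by (auto simp: indicator_def)
    show "r x + (\<Sum>e\<in>S. g e * indicator (e - {v} \<union> B) x) = indicator (X - {v} \<union> B) x"
      using 1 2 3 by linarith
  qed
  finally show ?thesis .
qed

section \<open>Fractional perfect matchings from the cone, and robustness under deletions\<close>

lemma simple_graph_finite_edges:
  assumes "simple_graph G"
  shows "finite (edges G)"
proof -
  have "edges G \<subseteq> Pow (verts G)" "finite (verts G)"
    using assms by (auto simp: simple_graph_def)
  then show ?thesis by (meson finite_Pow_iff finite_subset)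
qed

lemma fractional_perfect_matching_delete:
  assumes G: "simple_graph G" and cone: "indicator (verts G - U) \<in> edge_cone (edges G - D)"
  shows "\<exists>g. fractional_perfect_matching (delete G U D) g"
proof -
  obtain g where g: "\<And>e. e \<in> edges G - D \<Longrightarrow> 0 \<le> g e"
    "\<And>x. (indicator (verts G - U) x :: real) = (\<Sum>e\<in>edges G - D. g e * indicator e x)"
    using cone by (rule edge_coneE) blast
  note fin = simple_graph_finite_edges[OF G]
  have le: "g e \<le> indicator (verts G - U) x" if "e \<in> edges G - D" "x \<in> e" for e x
  proof -
    have "g e * indicator e x \<le> (\<Sum>e\<in>edges G - D. g e * indicator e x)"
      using that g fin by (intro member_le_sum) auto
    then show ?thesis using that g(2)[of x] by simp
  qed
  have "g e \<le> 1" if e: "e \<in> edges G - D" for e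
  proof -
    have "card e = 2" using G e by (auto simp: simple_graph_def)
    then obtain x where x: "x \<in> e" by fastforce
    show ?thesis
      using le[OF e x] by (rule order.trans) (auto simp: indicator_def)
  qed
  moreover have "(\<Sum>e\<in>{e \<in> edges (delete G U D). x \<in> e}. g e) = 1" if x: "x \<in> verts G - U" for x
  proof -
    have "(\<Sum>e\<in>{e \<in> edges (delete G U D). x \<in> e}. g e) = (\<Sum>e\<in>edges G - D. g e * indicator e x)"
    proof (rule sum.mono_neutral_cong_left)
      show "\<forall>e\<in>edges G - D - {e \<in> edges (delete G U D). x \<in> e}. g e * indicator e x = 0"
      proof
        fix e assume e: "e \<in> edges G - D - {e \<in> edges (delete G U D). x \<in> e}"
        show "g e * indicator e x = 0"
        proof (cases "x \<in> e")
          case True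
          then obtain u where u: "u \<in> e" "u \<in> U" using e by (auto simp: delete_def)
          have "g e \<le> 0" using le[of e u] u e by auto
          then show ?thesis using g(1)[of e] e by simp
        qed simp
      qed
    qed (use fin in \<open>auto simp: delete_def\<close>)
    also have "\<dots> = 1" using g(2)[of x] x by simp
    finally show ?thesis .
  qed
  ultimately have "fractional_perfect_matching (delete G U D) g"
    using g(1) by (auto simp: fractional_perfect_matching_def delete_def)
  then show ?thesis by (rule exI[of _ g])
qed

text \<open>Deleting one vertex and one edge can destroy all fractional perfect matchings of
  \<open>G(8,4)\<close>, and one vertex and two edges can do so for members of \<open>RHL 4\<close>: this is the
  reason for the exception.\<close>

definition robust :: "nat \<Rightarrow> 'a graph \<Rightarrow> bool" where
  "robust k G \<longleftrightarrow> (\<forall>U D. U \<subseteq> verts G \<longrightarrow> D \<subseteq> edges G \<longrightarrow> card U + card D \<le> k \<longrightarrow>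
     \<not> (card U = 1 \<and> card U + card D = k) \<longrightarrow> indicator (verts G - U) \<in> edge_cone (edges G - D))"

lemma robustD:
  assumes "robust k G" "U \<subseteq> verts G" "D \<subseteq> edges G" "card U + card D \<le> k"
    "\<not> (card U = 1 \<and> card U + card D = k)"
  shows "indicator (verts G - U) \<in> edge_cone (edges G - D)"
  using assms unfolding robust_def by blast

section \<open>The base case: \<open>G84\<close> as a Mobius ladder\<close>

text \<open>This is the Wagner graph: an 8-cycle \<open>x0, ..., x7\<close> with chords between
  opposite vertices. The edges are listed as three perfect matchings: the two alternating halves of
  the cycle, then the chords.\<close>

definition mobius_ladder :: "'a graph \<Rightarrow> 'a \<Rightarrow> 'a \<Rightarrow> 'a \<Rightarrow> 'a \<Rightarrow> 'a \<Rightarrow> 'a \<Rightarrow> 'a \<Rightarrow> 'a \<Rightarrow> bool" where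
  "mobius_ladder G x0 x1 x2 x3 x4 x5 x6 x7 \<longleftrightarrow>
     distinct [x0, x1, x2, x3, x4, x5, x6, x7] \<and> verts G = {x0, x1, x2, x3, x4, x5, x6, x7} \<and>
     edges G = {{x0, x1}, {x2, x3}, {x4, x5}, {x6, x7}, {x1, x2}, {x3, x4}, {x5, x6}, {x7, x0},
       {x0, x4}, {x1, x5}, {x2, x6}, {x3, x7}}"

lemma mobius_ladder_rotate:
  assumes "mobius_ladder G x0 x1 x2 x3 x4 x5 x6 x7"
  shows "mobius_ladder G x1 x2 x3 x4 x5 x6 x7 x0"
proof -
  have "{{x0, x1}, {x2, x3}, {x4, x5}, {x6, x7}, {x1, x2}, {x3, x4}, {x5, x6}, {x7, x0},
       {x0, x4}, {x1, x5}, {x2, x6}, {x3, x7}} =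
     {{x1, x2}, {x3, x4}, {x5, x6}, {x7, x0}, {x2, x3}, {x4, x5}, {x6, x7}, {x0, x1},
       {x1, x5}, {x2, x6}, {x3, x7}, {x4, x0}}"
    by (simp add: insert_commute)
  moreover have "{x0, x1, x2, x3, x4, x5, x6, x7} = {x1, x2, x3, x4, x5, x6, x7, x0}"
    by (simp add: insert_commute)
  moreover have "distinct [x1, x2, x3, x4, x5, x6, x7, x0]"
    using assms unfolding mobius_ladder_def by auto
  ultimately show ?thesis
    using assms unfolding mobius_ladder_def by argo
qed

lemma int_atLeastAtMost_0_7: "{0..7::int} = {0, 1, 2, 3, 4, 5, 6, 7}"
  by auto

lemma edges_G84:
  "edges G84 = {{0, 1}, {2, 3}, {4, 5}, {6, 7}, {1, 2}, {3, 4}, {5, 6}, {7, 0},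
     {0, 4}, {1, 5}, {2, 6}, {3, 7}}" (is "_ = ?E")
proof
  show "edges G84 \<subseteq> ?E"
  proof
    fix e assume "e \<in> edges G84"
    then obtain u v where e: "e = {u, v}" and uv: "u \<in> {0..7}" "v \<in> {0..7}"
      "[u - v = 1] (mod 8) \<or> [u - v = - 1] (mod 8) \<or> [u - v = 4] (mod 8)"
      unfolding G84_def by auto
    have "(u - v) mod 8 \<in> {1, 7, 4}" using uv(3) by (auto simp: cong_def)
    \<comment> \<open>The difference lies between -7 and 7, so each of the three residues has two
      representatives.\<close>
    then have "u = v + 1 \<or> u = v - 1 \<or> u = v + 4 \<or> u = v - 4 \<or> u = v + 7 \<or> u = v - 7"
      using uv(1,2) unfolding atLeastAtMost_iff insert_iff empty_iff by presburger
    then consider "u = v + 1" | "u = v - 1" | "u = v + 4" | "u = v - 4" | "u = v + 7" | "u = v - 7"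
      by blast
    then show "e \<in> ?E"
    proof cases
      case 1
      then have "v \<in> {0, 1, 2, 3, 4, 5, 6}" using uv(1,2) by auto
      then show ?thesis unfolding e 1 by (elim insertE emptyE) (simp_all add: insert_commute)
    next
      case 2
      then have "u \<in> {0, 1, 2, 3, 4, 5, 6}" "v = u + 1" using uv(1,2) by auto
      then show ?thesis unfolding e by (elim insertE emptyE) (simp_all add: insert_commute)
    next
      case 3
      then have "v \<in> {0, 1, 2, 3}" using uv(1,2) by auto
      then show ?thesis unfolding e 3 by (elim insertE emptyE) (simp_all add: insert_commute)
    next
      case 4
      then have "u \<in> {0, 1, 2, 3}" "v = u + 4" using uv(1,2) by auto
      then show ?thesis unfolding e by (elim insertE emptyE) (simp_all add: insert_commute)
    next
      case 5
      then have "u = 7" "v = 0" using uv(1,2) by auto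
      then show ?thesis unfolding e by simp
    next
      case 6
      then have "u = 0" "v = 7" using uv(1,2) by auto
      then show ?thesis unfolding e by (simp add: insert_commute)
    qed
  qed
  \<comment> \<open>Every edge of the explicit list is written with its ends in an order that gives
    one of these three differences.\<close>
  have edge: "{u, v} \<in> edges G84" if "u \<in> {0..7}" "v \<in> {0..7}" "u - v \<in> {-1, -4, 7}" for u v
  proof -
    have "[u - v = 1] (mod 8) \<or> [u - v = - 1] (mod 8) \<or> [u - v = 4] (mod 8)"
      using that(3) by (auto simp: cong_def)
    with that(1,2) show ?thesis unfolding G84_def by auto
  qed
  show "?E \<subseteq> edges G84"
    using edge[of 0 1] edge[of 2 3] edge[of 4 5] edge[of 6 7] edge[of 1 2] edge[of 3 4]
      edge[of 5 6] edge[of 7 0] edge[of 0 4] edge[of 1 5] edge[of 2 6] edge[of 3 7]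
    by simp
qed

text \<open>Rotating the cycle is a symmetry, so any vertex can be given the first label. Case
  distinctions on deleted vertices may then start from a fixed one.\<close>

lemma isomorphic_G84_mobius_ladder:
  assumes "isomorphic G84 G" "u \<in> verts G"
  obtains x1 x2 x3 x4 x5 x6 x7 where "mobius_ladder G u x1 x2 x3 x4 x5 x6 x7"
proof -
  obtain f where f: "bij_betw f (verts G84) (verts G)" "edges G = (\<lambda>e. f ` e) ` edges G84"
    using assms(1) unfolding isomorphic_def by blast
  have V: "verts G84 = {0, 1, 2, 3, 4, 5, 6, 7}"
    unfolding int_atLeastAtMost_0_7[symmetric] by (simp add: G84_def)
  have m: "mobius_ladder G (f 0) (f 1) (f 2) (f 3) (f 4) (f 5) (f 6) (f 7)"
    using f unfolding mobius_ladder_def V edges_G84 bij_betw_def inj_on_def by auto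
  from assms(2) have "u \<in> {f 0, f 1, f 2, f 3, f 4, f 5, f 6, f 7}"
    using m unfolding mobius_ladder_def by argo
  then show thesis
  proof (elim insertE emptyE)
    assume "u = f 0" then show thesis using that m by blast
  next
    note m = m[THEN mobius_ladder_rotate]
    assume "u = f 1" then show thesis using that m by blast
  next
    note m = m[THEN mobius_ladder_rotate, THEN mobius_ladder_rotate]
    assume "u = f 2" then show thesis using that m by blast
  next
    note m = m[THEN mobius_ladder_rotate, THEN mobius_ladder_rotate, THEN mobius_ladder_rotate]
    assume "u = f 3" then show thesis using that m by blast
  next
    note m = m[THEN mobius_ladder_rotate, THEN mobius_ladder_rotate, THEN mobius_ladder_rotate,
        THEN mobius_ladder_rotate]
    assume "u = f 4" then show thesis using that m by blast
  next
    note m = m[THEN mobius_ladder_rotate, THEN mobius_ladder_rotate, THEN mobius_ladder_rotate,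
        THEN mobius_ladder_rotate, THEN mobius_ladder_rotate]
    assume "u = f 5" then show thesis using that m by blast
  next
    note m = m[THEN mobius_ladder_rotate, THEN mobius_ladder_rotate, THEN mobius_ladder_rotate,
        THEN mobius_ladder_rotate, THEN mobius_ladder_rotate, THEN mobius_ladder_rotate]
    assume "u = f 6" then show thesis using that m by blast
  next
    note m = m[THEN mobius_ladder_rotate, THEN mobius_ladder_rotate, THEN mobius_ladder_rotate,
        THEN mobius_ladder_rotate, THEN mobius_ladder_rotate, THEN mobius_ladder_rotate,
        THEN mobius_ladder_rotate]
    assume "u = f 7" then show thesis using that m by blast
  qed
qed

lemma indicator_empty_in_edge_cone: "indicator {} \<in> edge_cone E"
  by (rule edge_coneI[where g = "\<lambda>_. 0"]) auto

lemma indicator_insert_edge_in_edge_cone: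
  assumes "finite E" "{a, b} \<in> E" "indicator A \<in> edge_cone E" "a \<notin> A" "b \<notin> A"
  shows "indicator (insert a (insert b A)) \<in> edge_cone E"
  using edge_cone_disjoint_Un[OF edge_in_edge_cone[OF assms(1,2)] assms(3)] assms(4,5) by simp

text \<open>Weight 1/2 on each edge of the cycle. An odd cycle has no perfect matching, so this is
  where genuinely fractional weights enter the base case.\<close>

lemma indicator_5_cycle_in_edge_cone:
  assumes "finite E" "{{a, b}, {b, c}, {c, d}, {d, e}, {e, a}} \<subseteq> E" "distinct [a, b, c, d, e]"
  shows "indicator {a, b, c, d, e} \<in> edge_cone E"
proof -
  have "(\<lambda>v. 1 / 2 * (indicator {a, b} v + (indicator {b, c} v + (indicator {c, d} v +
      (indicator {d, e} v + indicator {e, a} v))))) \<in> edge_cone E"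
    using assms(1,2) by (intro edge_cone_scale edge_cone_add edge_in_edge_cone) auto
  also have "(\<lambda>v. 1 / 2 * (indicator {a, b} v + (indicator {b, c} v + (indicator {c, d} v +
      (indicator {d, e} v + indicator {e, a} v))))) = (indicator {a, b, c, d, e} :: _ \<Rightarrow> real)"
    using assms(3)
    by (intro ext, rename_tac v, case_tac "v = a"; case_tac "v = b"; case_tac "v = c"; case_tac "v = d";
        case_tac "v = e") simp_all
  finally show ?thesis .
qed

text \<open>Pigeonhole: meeting all three sets takes three distinct elements. It is applied to three
  pairwise disjoint perfect matchings and a set of deleted edges.\<close>

lemma small_set_avoids_one_of_three:
  assumes "A \<inter> B = {}" "A \<inter> C = {}" "B \<inter> C = {}" "finite D" "card D \<le> 2"
  shows "A \<inter> D = {} \<or> B \<inter> D = {} \<or> C \<inter> D = {}"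
proof (rule ccontr)
  assume "\<not> ?thesis"
  then obtain a b c where abc: "a \<in> A \<inter> D" "b \<in> B \<inter> D" "c \<in> C \<inter> D"
    by (metis all_not_in_conv)
  then have "a \<noteq> b" "a \<noteq> c" "b \<noteq> c" using assms(1-3) by auto
  then have "card {a, b, c} = 3" by simp
  moreover have "card {a, b, c} \<le> card D" using abc assms(4) by (intro card_mono) auto
  ultimately show False using assms(5) by linarith
qed

lemma isomorphic_verts_nonempty:
  assumes "isomorphic G H" "v \<in> verts G"
  shows "verts H \<noteq> {}"
  using assms unfolding isomorphic_def bij_betw_def by blast

text \<open>With no deleted vertex, one of three disjoint perfect matchings survives. With one, a
  5-cycle and a disjoint edge cover the rest. With two, the remaining six vertices have a perfect
  matching.\<close>

lemma robust_G84:
  assumes "isomorphic G84 G"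
  shows "robust 2 G"
  unfolding robust_def
proof (intro allI impI)
  fix U D
  assume UD: "U \<subseteq> verts G" "D \<subseteq> edges G" "card U + card D \<le> 2"
    "\<not> (card U = 1 \<and> card U + card D = 2)"
  have simple: "simple_graph G" using assms by (simp add: isomorphic_def)
  note finE = simple_graph_finite_edges[OF simple]
  have fin: "finite U" "finite D"
    using UD(1,2) simple finE by (auto simp: simple_graph_def intro: finite_subset)
  have "card U = 0 \<or> card U = 1 \<or> card U = 2" using UD(3) by linarith
  then show "indicator (verts G - U) \<in> edge_cone (edges G - D)"
  proof (elim disjE)
    assume "card U = 0"
    then have "U = {}" using fin by simp
    have "verts G \<noteq> {}"
      using assms by (rule isomorphic_verts_nonempty[where v = 0]) (simp add: G84_def)
    then obtain u where "u \<in> verts G" by blast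
    with assms obtain x1 x2 x3 x4 x5 x6 x7 where m: "mobius_ladder G u x1 x2 x3 x4 x5 x6 x7"
      by (rule isomorphic_G84_mobius_ladder)
    have d: "distinct [u, x1, x2, x3, x4, x5, x6, x7]"
      and V: "verts G = {u, x1, x2, x3, x4, x5, x6, x7}"
      and E: "edges G = {{u, x1}, {x2, x3}, {x4, x5}, {x6, x7}, {x1, x2}, {x3, x4}, {x5, x6},
        {x7, u}, {u, x4}, {x1, x5}, {x2, x6}, {x3, x7}}"
      using m unfolding mobius_ladder_def by (simp_all only:)
    \<comment> \<open>The alternating halves of the cycle and the four chords.\<close>
    define M1 where "M1 = {{u, x1}, {x2, x3}, {x4, x5}, {x6, x7}}"
    define M2 where "M2 = {{x1, x2}, {x3, x4}, {x5, x6}, {x7, u}}"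
    define M3 where "M3 = {{u, x4}, {x1, x5}, {x2, x6}, {x3, x7}}"
    have "M1 \<inter> M2 = {}" "M1 \<inter> M3 = {}" "M2 \<inter> M3 = {}"
      using d unfolding M1_def M2_def M3_def by (simp_all add: doubleton_eq_iff)
    then have "M1 \<inter> D = {} \<or> M2 \<inter> D = {} \<or> M3 \<inter> D = {}"
      using fin(2) UD(3) by (intro small_set_avoids_one_of_three) auto
    moreover have "M1 \<union> M2 \<union> M3 \<subseteq> edges G"
      by (simp add: M1_def M2_def M3_def E)
    moreover have "indicator (verts G) \<in> edge_cone M1"
    proof -
      have "indicator {u, x1, x2, x3, x4, x5, x6, x7} \<in> edge_cone M1"
        by (intro indicator_insert_edge_in_edge_cone indicator_empty_in_edge_cone)
          (use d in \<open>auto simp: M1_def\<close>)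
      then show ?thesis using V by simp
    qed
    moreover have "indicator (verts G) \<in> edge_cone M2"
    proof -
      have "indicator {x1, x2, x3, x4, x5, x6, x7, u} \<in> edge_cone M2"
        by (intro indicator_insert_edge_in_edge_cone indicator_empty_in_edge_cone)
          (use d in \<open>auto simp: M2_def\<close>)
      then show ?thesis using V by (simp add: insert_commute)
    qed
    moreover have "indicator (verts G) \<in> edge_cone M3"
    proof -
      have "indicator {u, x4, x1, x5, x2, x6, x3, x7} \<in> edge_cone M3"
        by (intro indicator_insert_edge_in_edge_cone indicator_empty_in_edge_cone)
          (use d in \<open>auto simp: M3_def\<close>)
      then show ?thesis using V by (simp add: insert_commute)
    qed
    ultimately obtain M where "indicator (verts G) \<in> edge_cone M" "M \<subseteq> edges G - D" by blast
    then have "indicator (verts G) \<in> edge_cone (edges G - D)"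
      by (rule edge_cone_mono) (use finE in simp)
    then show ?thesis using \<open>U = {}\<close> by simp
  next
    assume "card U = 1"
    then have "card D = 0" using UD(3,4) by linarith
    then have D: "D = {}" using fin by simp
    obtain u where u: "U = {u}" using \<open>card U = 1\<close> by (rule card_1_singletonE)
    then have "u \<in> verts G" using UD by simp
    with assms obtain x1 x2 x3 x4 x5 x6 x7 where m: "mobius_ladder G u x1 x2 x3 x4 x5 x6 x7"
      by (rule isomorphic_G84_mobius_ladder)
    \<comment> \<open>The path from \<open>x1\<close> to \<open>x5\<close> is closed by the chord
      \<open>{x1, x5}\<close>; the edge \<open>{x6, x7}\<close> remains.\<close>
    have "indicator {x1, x2, x3, x4, x5} \<in> edge_cone (edges G)"
      by (rule indicator_5_cycle_in_edge_cone[OF finE])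
        (use m in \<open>simp_all add: mobius_ladder_def insert_commute\<close>)
    then have "indicator {x6, x7, x1, x2, x3, x4, x5} \<in> edge_cone (edges G)"
      by (rule indicator_insert_edge_in_edge_cone[OF finE, rotated])
        (use m in \<open>auto simp: mobius_ladder_def\<close>)
    also have "{x6, x7, x1, x2, x3, x4, x5} = verts G - U"
      using m u by (auto simp: mobius_ladder_def)
    finally show ?thesis using D by simp
  next
    assume U2: "card U = 2"
    then have D: "D = {}" using UD(3) fin by simp
    obtain u w where u: "U = {u, w}" "u \<noteq> w" using U2 by (meson card_2_iff)
    then have "u \<in> verts G" using UD by simp
    with assms obtain x1 x2 x3 x4 x5 x6 x7 where m: "mobius_ladder G u x1 x2 x3 x4 x5 x6 x7"
      by (rule isomorphic_G84_mobius_ladder)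
    have d: "distinct [u, x1, x2, x3, x4, x5, x6, x7]"
      and V: "verts G = {u, x1, x2, x3, x4, x5, x6, x7}"
      and E: "edges G = {{u, x1}, {x2, x3}, {x4, x5}, {x6, x7}, {x1, x2}, {x3, x4}, {x5, x6},
        {x7, u}, {u, x4}, {x1, x5}, {x2, x6}, {x3, x7}}"
      using m unfolding mobius_ladder_def by (simp_all only:)
    have matching: "indicator (verts G - U) \<in> edge_cone (edges G)"
      if "{a1, b1} \<in> edges G" "{a2, b2} \<in> edges G" "{a3, b3} \<in> edges G"
        "distinct [a1, b1, a2, b2, a3, b3]" "verts G - U = {a1, b1, a2, b2, a3, b3}"
      for a1 b1 a2 b2 a3 b3
      unfolding that(5)
      by (intro indicator_insert_edge_in_edge_cone indicator_empty_in_edge_cone finE)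
        (use that in auto)
    have "w \<in> {x1, x2, x3, x4, x5, x6, x7}" using UD u V by auto
    then have "indicator (verts G - U) \<in> edge_cone (edges G)"
    \<comment> \<open>If \<open>w\<close> has odd index, both arcs between \<open>u\<close> and
      \<open>w\<close> have an even number of vertices and cycle edges suffice. If it has even
      index, both arcs are odd and one chord joins them, chosen so that the pieces left over are
      even.\<close>
    proof (elim insertE emptyE)
      assume "w = x1"
      then show ?thesis
        by (intro matching[of x2 x3 x4 x5 x6 x7]) (use d in \<open>auto simp: V E u\<close>)
    next
      assume "w = x2"
      then show ?thesis
        by (intro matching[of x1 x5 x3 x4 x6 x7]) (use d in \<open>auto simp: V E u\<close>)
    next
      assume "w = x3"
      then show ?thesis
        by (intro matching[of x1 x2 x4 x5 x6 x7]) (use d in \<open>auto simp: V E u\<close>)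
    next
      assume "w = x4"
      then show ?thesis
        by (intro matching[of x1 x2 x3 x7 x5 x6]) (use d in \<open>auto simp: V E u\<close>)
    next
      assume "w = x5"
      then show ?thesis
        by (intro matching[of x1 x2 x3 x4 x6 x7]) (use d in \<open>auto simp: V E u\<close>)
    next
      assume "w = x6"
      then show ?thesis
        by (intro matching[of x1 x2 x3 x7 x4 x5]) (use d in \<open>auto simp: V E u\<close>)
    next
      assume "w = x7"
      then show ?thesis
        by (intro matching[of x1 x2 x3 x4 x5 x6]) (use d in \<open>auto simp: V E u\<close>)
    qed
    then show ?thesis using D by simp
  qed
qed

section \<open>The inductive step: deletions in \<open>oplus\<close>\<close>

text \<open>Allows arguments that single out \<open>G0\<close> to be applied to
  \<open>G1\<close>.\<close>

lemma oplus_commute: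
  assumes "bij_betw \<phi> (verts G0) (verts G1)"
  shows "oplus \<phi> G0 G1 = oplus (inv_into (verts G0) \<phi>) G1 G0"
proof -
  have "{{v, \<phi> v} | v. v \<in> verts G0} = {{v, inv_into (verts G0) \<phi> v} | v. v \<in> verts G1}"
    (is "?L = ?R")
  proof (intro set_eqI iffI)
    fix e assume "e \<in> ?L"
    then obtain v where v: "v \<in> verts G0" "e = {v, \<phi> v}" by blast
    then have "inv_into (verts G0) \<phi> (\<phi> v) = v" "\<phi> v \<in> verts G1"
      using assms by (auto simp: bij_betw_def)
    then show "e \<in> ?R" using v by (auto intro!: exI[of _ "\<phi> v"])
  next
    fix e assume "e \<in> ?R"
    then obtain v where v: "v \<in> verts G1" "e = {v, inv_into (verts G0) \<phi> v}" by blast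
    then have "\<phi> (inv_into (verts G0) \<phi> v) = v" "inv_into (verts G0) \<phi> v \<in> verts G0"
      using assms by (auto simp: bij_betw_def f_inv_into_f inv_into_into)
    then show "e \<in> ?L" using v by (auto intro!: exI[of _ "inv_into (verts G0) \<phi> v"])
  qed
  then show ?thesis by (simp add: oplus_def Un_commute)
qed

lemma simple_graph_oplus:
  assumes "simple_graph G0" "simple_graph G1" "verts G0 \<inter> verts G1 = {}"
    "bij_betw \<phi> (verts G0) (verts G1)"
  shows "simple_graph (oplus \<phi> G0 G1)"
proof -
  have "card {v, \<phi> v} = 2" "\<phi> v \<in> verts G1" if "v \<in> verts G0" for v
    using that assms(3,4) by (auto simp: bij_betw_def card_insert_if)
  then have "e \<subseteq> verts G0 \<union> verts G1 \<and> card e = 2" if "e \<in> edges (oplus \<phi> G0 G1)" for e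
    using that assms(1,2) unfolding simple_graph_def oplus_def by auto
  then show ?thesis using assms(1,2) by (auto simp: simple_graph_def oplus_def)
qed

text \<open>Handles the case where \<open>robust k G0\<close> says nothing about the deletions
  inside \<open>G0\<close>; this is what the premise \<open>bad\<close> expresses. At least
  \<open>k\<close> of the at most \<open>Suc k\<close> deletions then lie in \<open>G0\<close>, so
  at most one lies elsewhere, and \<open>G1\<close> can spare the partners of the vertices of
  \<open>G0\<close> that lose weight.\<close>

lemma robust_oplus_aux:
  assumes G: "simple_graph G0" "simple_graph G1" and disj: "verts G0 \<inter> verts G1 = {}"
    and bij: "bij_betw \<phi> (verts G0) (verts G1)"
    and rob: "robust k G0" "robust k G1" and k: "2 \<le> k"
    and U: "U \<subseteq> verts (oplus \<phi> G0 G1)" and D: "D \<subseteq> edges (oplus \<phi> G0 G1)"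
    and total: "card U + card D \<le> Suc k"
    and exc: "3 \<le> k \<or> \<not> (card U = 1 \<and> card U + card D = Suc k)"
    and bad: "card (U \<inter> verts G0) + card (D \<inter> edges G0) > k \<or>
      (card (U \<inter> verts G0) = 1 \<and> card (U \<inter> verts G0) + card (D \<inter> edges G0) = k)"
  shows "indicator (verts (oplus \<phi> G0 G1) - U) \<in> edge_cone (edges (oplus \<phi> G0 G1) - D)"
proof -
  let ?V0 = "verts G0" and ?V1 = "verts G1" and ?E0 = "edges G0" and ?E1 = "edges G1"
  let ?G = "oplus \<phi> G0 G1"
  define E where "E = edges ?G - D"
  define M where "M = {{v, \<phi> v} | v. v \<in> ?V0}"
  define U0 where "U0 = U \<inter> ?V0"
  define U1 where "U1 = U \<inter> ?V1"
  define D0 where "D0 = D \<inter> ?E0"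
  define D1 where "D1 = D \<inter> ?E1"
  define DM where "DM = D \<inter> M"
  have VG: "verts ?G = ?V0 \<union> ?V1" and EG: "edges ?G = ?E0 \<union> ?E1 \<union> M"
    by (simp_all add: oplus_def M_def)
  have simple: "simple_graph ?G" using G disj bij by (rule simple_graph_oplus)
  have finV: "finite (verts ?G)" using simple by (simp add: simple_graph_def)
  have finE: "finite (edges ?G)" using simple by (rule simple_graph_finite_edges)
  have fin: "finite U" "finite D" "finite U0" "finite U1" "finite D0" "finite D1" "finite DM" "finite E"
    using finite_subset[OF U finV] finite_subset[OF D finE] finE
    by (simp_all add: U0_def U1_def D0_def D1_def DM_def E_def)
  have sub0: "e \<subseteq> ?V0" "card e = 2" if "e \<in> ?E0" for e using that G(1) by (auto simp: simple_graph_def)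
  have sub1: "e \<subseteq> ?V1" "card e = 2" if "e \<in> ?E1" for e using that G(2) by (auto simp: simple_graph_def)
  have \<phi>: "\<phi> v \<in> ?V1" if "v \<in> ?V0" for v using that bij by (auto simp: bij_betw_def)
  have inj: "inj_on \<phi> ?V0" using bij by (simp add: bij_betw_def)
  have E01: "?E0 \<inter> ?E1 = {}"
  proof (rule ccontr)
    assume "\<not> ?thesis"
    then obtain e where "e \<in> ?E0" "e \<in> ?E1" by blast
    then have "e = {}" "card e = 2" using sub0[of e] sub1[of e] disj by blast+
    then show False by simp
  qed
  have EM: "?E0 \<inter> M = {}" "?E1 \<inter> M = {}"
    using sub0(1) sub1(1) disj \<phi> by (fastforce simp: M_def)+
  have cU: "card U = card U0 + card U1"
  proof -
    have "U = U0 \<union> U1" "U0 \<inter> U1 = {}" using U VG disj by (auto simp: U0_def U1_def)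
    then show ?thesis using fin by (simp add: card_Un_disjoint)
  qed
  have cD: "card D = card D0 + card D1 + card DM"
  proof -
    have "D = (D0 \<union> D1) \<union> DM" using D EG by (auto simp: D0_def D1_def DM_def)
    moreover have "D0 \<inter> D1 = {}" "(D0 \<union> D1) \<inter> DM = {}"
      using E01 EM by (auto simp: D0_def D1_def DM_def)
    ultimately show ?thesis using fin by (simp add: card_Un_disjoint)
  qed
  have bad: "card U0 + card D0 > k \<or> (card U0 = 1 \<and> card U0 + card D0 = k)"
    using bad by (simp add: U0_def D0_def)
  define B where "B = ?V1 - U1"
  have target: "verts ?G - U = (?V0 - U0) \<union> B"
    using disj by (auto simp: VG U0_def U1_def B_def)
  have cone1: "indicator A \<in> edge_cone E" if "indicator A \<in> edge_cone (?E1 - D1)" for A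
    using that by (rule edge_cone_mono) (use fin in \<open>auto simp: E_def EG D1_def\<close>)
  \<comment> \<open>A vertex \<open>y\<close> of \<open>G0\<close> joins a covered set by taking
    over its partner \<open>\<phi> y\<close> through their cross edge.\<close>
  have attach: "indicator (insert y A) \<in> edge_cone E"
    if "indicator (A - {\<phi> y}) \<in> edge_cone E" "y \<in> ?V0" "\<phi> y \<in> A" "{y, \<phi> y} \<notin> D" "y \<notin> A" for y A
  proof -
    have "{y, \<phi> y} \<in> E" using that by (auto simp: E_def EG M_def)
    then have "indicator (insert y (insert (\<phi> y) (A - {\<phi> y}))) \<in> edge_cone E"
      using that by (intro indicator_insert_edge_in_edge_cone fin) auto
    then show ?thesis using that(3) by (simp add: insert_absorb)
  qed
  \<comment> \<open>By default a deleted vertex of \<open>G0\<close> is restored. This is impossible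
    if there is none. If \<open>G0\<close> has two deleted vertices and \<open>Suc k\<close>
    deletions in all, restoring one leaves one vertex and \<open>k\<close> deletions, the exception
    in \<open>robust\<close>. In these two situations an edge is restored instead.\<close>
  show ?thesis
  proof (cases "U0 = {} \<or> (card U0 = 2 \<and> card U0 + card D0 = Suc k)")
    case False
    then obtain v where v: "v \<in> U0" by blast
    then have v0: "v \<in> ?V0" by (simp add: U0_def)
    \<comment> \<open>\<open>Y\<close> collects the vertices that cannot use their partner, because
      the partner or the cross edge is deleted. Deleting also the edges \<open>N\<close> from
      \<open>v\<close> to \<open>Y\<close> ensures that the restored \<open>v\<close> is matched
      only to vertices with an available partner.\<close>
    define Y where "Y = {x \<in> ?V0. \<phi> x \<in> U1 \<or> {x, \<phi> x} \<in> DM}"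
    define N where "N = (\<lambda>x. {v, x}) ` Y \<inter> ?E0"
    have "finite ?V0" using G(1) by (simp add: simple_graph_def)
    then have finY: "finite Y" by (simp add: Y_def)
    \<comment> \<open>Each member of \<open>Y\<close> is charged to its deleted partner or its
      deleted cross edge; both charges are injective.\<close>
    have "card Y \<le> card U1 + card DM"
    proof -
      have "card {x \<in> ?V0. \<phi> x \<in> U1} \<le> card U1"
        by (rule card_inj_on_le[of \<phi>]) (use inj fin in \<open>auto intro: inj_on_subset\<close>)
      moreover have "card {x \<in> ?V0. {x, \<phi> x} \<in> DM} \<le> card DM"
      proof (rule card_inj_on_le[of "\<lambda>x. {x, \<phi> x}"])
        show "inj_on (\<lambda>x. {x, \<phi> x}) {x \<in> ?V0. {x, \<phi> x} \<in> DM}"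
          using disj \<phi> by (auto simp: inj_on_def doubleton_eq_iff)
      qed (use fin in auto)
      moreover have "card Y \<le> card {x \<in> ?V0. \<phi> x \<in> U1} + card {x \<in> ?V0. {x, \<phi> x} \<in> DM}"
        unfolding Y_def Collect_disj_eq conj_disj_distribL by (rule card_Un_le)
      ultimately show ?thesis by linarith
    qed
    moreover have "card N \<le> card Y"
      unfolding N_def using finY
      by (meson card_image_le card_mono finite_imageI inf_le1 order.trans)
    ultimately have cN: "card N \<le> card U1 + card DM" by linarith
    have cDN: "card (D0 \<union> N) \<le> card D0 + card N" by (rule card_Un_le)
    have cU0: "Suc (card (U0 - {v})) = card U0" using v fin by (intro card.remove[symmetric])
    \<comment> \<open>\<open>N\<close> costs at most \<open>card U1 + card DM\<close>, deletions
      already counted outside \<open>G0\<close>, and restoring \<open>v\<close> saves one. Hence the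
      total is at most \<open>k\<close>.\<close>
    have "indicator (?V0 - (U0 - {v})) \<in> edge_cone (?E0 - (D0 \<union> N))"
    proof (rule robustD[OF rob(1)])
      show "card (U0 - {v}) + card (D0 \<union> N) \<le> k"
        using cN cDN cU0 cU cD total by linarith
      show "\<not> (card (U0 - {v}) = 1 \<and> card (U0 - {v}) + card (D0 \<union> N) = k)"
      proof
        assume *: "card (U0 - {v}) = 1 \<and> card (U0 - {v}) + card (D0 \<union> N) = k"
        then have "card U0 = 2" using cU0 by linarith
        then have "card U0 + card D0 = Suc k" using bad cU cD total by linarith
        then show False using False \<open>card U0 = 2\<close> by simp
      qed
    qed (auto simp: U0_def D0_def N_def)
    then have "indicator (?V0 - (U0 - {v}) - {v} \<union> B) \<in> edge_cone E"
    proof (rule edge_cone_reroute_vertex)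
      show "v \<in> ?V0 - (U0 - {v})" using v0 by simp
      show "v \<notin> B" using v0 disj by (auto simp: B_def)
      show "finite (?E0 - (D0 \<union> N))" using finE by (simp add: EG)
      show "finite E" by (rule fin)
      show "(?V0 - (U0 - {v})) \<inter> B = {}" using disj by (auto simp: B_def)
      show "e \<inter> B = {}" if "e \<in> ?E0 - (D0 \<union> N)" for e
        using sub0(1)[of e] that disj by (auto simp: B_def)
      show "e \<in> E" if "e \<in> ?E0 - (D0 \<union> N)" "v \<notin> e" for e
        using that by (auto simp: E_def EG D0_def)
      show "indicator (e - {v} \<union> B) \<in> edge_cone E" if e: "e \<in> ?E0 - (D0 \<union> N)" "v \<in> e" for e
      proof -
        have "card e = 2" using e sub0 by blast
        then obtain y where y: "e = {v, y}" "y \<noteq> v"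
          using e(2) by (auto simp: card_2_iff doubleton_eq_iff)
        have y0: "y \<in> ?V0" using sub0(1)[of e] e y by auto
        have "y \<notin> Y" using e y by (auto simp: N_def)
        then have Y: "\<phi> y \<notin> U1" "{y, \<phi> y} \<notin> D"
          using y0 by (auto simp: Y_def DM_def M_def)
        have c: "card (insert (\<phi> y) U1) = Suc (card U1)" using Y fin by simp
        \<comment> \<open>By \<open>bad\<close>, \<open>card U1 + card D1\<close> is at most 1, so
          the extra vertex makes at most \<open>2 \<le> k\<close> deletions. The exception of
          \<open>robust\<close> could arise only for \<open>k = 2\<close> with one deleted vertex in
          \<open>G0\<close> and one deleted edge in \<open>G1\<close>, which \<open>exc\<close>
          rules out.\<close>
        have "indicator (?V1 - insert (\<phi> y) U1) \<in> edge_cone (?E1 - D1)"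
        proof (rule robustD[OF rob(2)])
          show "card (insert (\<phi> y) U1) + card D1 \<le> k"
            using c bad cU cD total k by linarith
          show "\<not> (card (insert (\<phi> y) U1) = 1 \<and> card (insert (\<phi> y) U1) + card D1 = k)"
            using c bad cU cD total k exc by linarith
        qed (use \<phi>[OF y0] in \<open>auto simp: U1_def D1_def\<close>)
        then have "indicator (?V1 - insert (\<phi> y) U1) \<in> edge_cone E" by (rule cone1)
        moreover have "?V1 - insert (\<phi> y) U1 = B - {\<phi> y}" by (auto simp: B_def)
        ultimately have "indicator (insert y B) \<in> edge_cone E"
          by (intro attach[of B y]) (use \<phi>[OF y0] y0 Y disj in \<open>auto simp: B_def\<close>)
        then show ?thesis using y by (simp add: insert_Diff_if)
      qed
    qed
    moreover have "?V0 - (U0 - {v}) - {v} = ?V0 - U0" using v by auto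
    ultimately show ?thesis unfolding target E_def[symmetric] by simp
  next
    case True
    \<comment> \<open>In both situations the deletions inside \<open>G0\<close> use up the whole
      budget \<open>Suc k\<close>, so \<open>G1\<close> and the cross edges are intact.\<close>
    then have sum: "card U0 + card D0 = Suc k" and U02: "card U0 = 0 \<or> card U0 = 2"
      using bad cU cD total by auto
    then have "U1 = {}" "D1 = {}" "DM = {}" using cU cD total fin by auto
    then have B: "B = ?V1" by (simp add: B_def)
    have "D0 \<noteq> {}" using sum U02 k by auto
    then obtain e where e: "e \<in> D0" by blast
    then have e0: "e \<in> ?E0" by (simp add: D0_def)
    have cD0: "Suc (card (D0 - {e})) = card D0" using e fin by (intro card.remove[symmetric])
    have c2: "card e = 2" using e0 by (rule sub0)
    then obtain x y where xy: "e = {x, y}" "x \<noteq> y" by (auto simp: card_2_iff)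
    have xy0: "x \<in> ?V0" "y \<in> ?V0" using sub0(1)[OF e0] xy by auto
    have "\<phi> x \<noteq> \<phi> y" using inj xy xy0 by (auto dest: inj_onD)
    \<comment> \<open>Restoring \<open>e\<close> leaves \<open>k\<close> deletions with zero or two
      vertices among them, so the exception does not apply.\<close>
    have "indicator (?V0 - U0) \<in> edge_cone (?E0 - (D0 - {e}))"
      by (rule robustD[OF rob(1)]) (use sum U02 cD0 in \<open>auto simp: U0_def D0_def\<close>)
    then have "indicator (?V0 - U0) \<in> edge_cone (insert e E)"
      by (rule edge_cone_mono) (use fin in \<open>auto simp: E_def EG D0_def\<close>)
    then have "indicator ((?V0 - U0) \<union> B) \<in> edge_cone E"
    proof (rule edge_cone_reroute_edge)
      have "indicator (?V1 - {}) \<in> edge_cone (?E1 - {})"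
        by (rule robustD[OF rob(2)]) auto
      then show "indicator B \<in> edge_cone E"
        using \<open>D1 = {}\<close> by (intro cone1) (simp add: B)
      \<comment> \<open>Two deleted vertices are within the bound since \<open>2 \<le> k\<close>.
        Afterwards \<open>x\<close> and \<open>y\<close> take over their partners one after the
        other, which covers \<open>e \<union> B\<close>.\<close>
      have "indicator (?V1 - {\<phi> x, \<phi> y}) \<in> edge_cone (?E1 - {})"
        by (rule robustD[OF rob(2)]) (use \<open>\<phi> x \<noteq> \<phi> y\<close> xy0 \<phi> k in auto)
      then have "indicator (B - {\<phi> x, \<phi> y}) \<in> edge_cone E"
        using \<open>D1 = {}\<close> by (intro cone1) (simp add: B)
      moreover have "B - {\<phi> x, \<phi> y} = B - {\<phi> x} - {\<phi> y}" by auto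
      moreover have DM: "{z, \<phi> z} \<notin> D" if "z \<in> ?V0" for z
        using that \<open>DM = {}\<close> by (auto simp: DM_def M_def)
      moreover have notin: "x \<notin> ?V1" "y \<notin> ?V1" using xy0 disj by auto
      ultimately have "indicator (insert y (B - {\<phi> x})) \<in> edge_cone E"
        by (intro attach[of "B - {\<phi> x}" y]) (use xy0 \<phi> \<open>\<phi> x \<noteq> \<phi> y\<close> in \<open>auto simp: B\<close>)
      moreover have "insert y (B - {\<phi> x}) = insert y B - {\<phi> x}"
        using notin xy0 \<phi> by auto
      ultimately have "indicator (insert x (insert y B)) \<in> edge_cone E"
        by (intro attach[of "insert y B" x]) (use xy xy0 \<phi> notin DM in \<open>auto simp: B\<close>)
      then show "indicator (e \<union> B) \<in> edge_cone E" using xy by simp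
      show "finite E" by (rule fin)
      show "e \<noteq> {}" using xy by simp
      show "(?V0 - U0) \<inter> B = {}" "e \<inter> B = {}" using disj xy xy0 by (auto simp: B_def)
    qed
    then show ?thesis unfolding target E_def .
  qed
qed

text \<open>If both halves cope with their own deletions, their matchings are added. Otherwise one
  half is overloaded and \<open>robust_oplus_aux\<close> applies, after swapping the halves if
  necessary.\<close>

lemma robust_oplus:
  assumes G: "simple_graph G0" "simple_graph G1" and disj: "verts G0 \<inter> verts G1 = {}"
    and bij: "bij_betw \<phi> (verts G0) (verts G1)"
    and rob: "robust k G0" "robust k G1" and k: "2 \<le> k"
    and U: "U \<subseteq> verts (oplus \<phi> G0 G1)" and D: "D \<subseteq> edges (oplus \<phi> G0 G1)"
    and total: "card U + card D \<le> Suc k"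
    and exc: "3 \<le> k \<or> \<not> (card U = 1 \<and> card U + card D = Suc k)"
  shows "indicator (verts (oplus \<phi> G0 G1) - U) \<in> edge_cone (edges (oplus \<phi> G0 G1) - D)"
proof -
  define bad where "bad H \<longleftrightarrow> card (U \<inter> verts H) + card (D \<inter> edges H) > k \<or>
      (card (U \<inter> verts H) = 1 \<and> card (U \<inter> verts H) + card (D \<inter> edges H) = k)" for H
  let ?\<psi> = "inv_into (verts G0) \<phi>"
  consider "bad G0" | "bad G1" | "\<not> bad G0" "\<not> bad G1" by blast
  then show ?thesis
  proof cases
    case 1
    then show ?thesis
      using robust_oplus_aux[OF G disj bij rob k U D total exc] by (simp add: bad_def)
  next
    case 2
    have eq: "oplus \<phi> G0 G1 = oplus ?\<psi> G1 G0" using bij by (rule oplus_commute)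
    have "bij_betw ?\<psi> (verts G1) (verts G0)" using bij by (rule bij_betw_inv_into)
    from robust_oplus_aux[OF G(2,1) _ this rob(2,1) k U[unfolded eq] D[unfolded eq] total exc]
    show ?thesis
      unfolding eq using 2 disj by (simp add: bad_def Int_commute)
  next
    case 3
    have fin: "finite (edges (oplus \<phi> G0 G1) - D)"
      using simple_graph_finite_edges[OF simple_graph_oplus[OF G disj bij]] by simp
    \<comment> \<open>Only edges inside \<open>H\<close> are used, so deleted cross edges do no harm
      here.\<close>
    have "indicator (verts H - (U \<inter> verts H)) \<in> edge_cone (edges (oplus \<phi> G0 G1) - D)"
      if "robust k H" "\<not> bad H" "edges H \<subseteq> edges (oplus \<phi> G0 G1)" for H
    proof -
      have "indicator (verts H - (U \<inter> verts H)) \<in> edge_cone (edges H - (D \<inter> edges H))"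
        using that(2) by (intro robustD[OF that(1)]) (auto simp: bad_def)
      then show ?thesis
        by (rule edge_cone_mono) (use that(3) fin in auto)
    qed
    from edge_cone_disjoint_Un[OF this[of G0] this[of G1]]
    have "indicator ((verts G0 - (U \<inter> verts G0)) \<union> (verts G1 - (U \<inter> verts G1)))
        \<in> edge_cone (edges (oplus \<phi> G0 G1) - D)"
      using 3 rob disj by (auto simp: oplus_def)
    also have "(verts G0 - (U \<inter> verts G0)) \<union> (verts G1 - (U \<inter> verts G1)) = verts (oplus \<phi> G0 G1) - U"
      by (auto simp: oplus_def)
    finally show ?thesis .
  qed
qed

section \<open>Lower bound: induction over the family\<close>

lemma RHL_Suc_cases:
  assumes "RHL (Suc n) G" "3 \<le> n"
  obtains G0 G1 \<phi> where "G = oplus \<phi> G0 G1" "RHL n G0" "RHL n G1"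
    "verts G0 \<inter> verts G1 = {}" "bij_betw \<phi> (verts G0) (verts G1)"
  using assms by (cases rule: RHL.cases) auto

lemma RHL_simple_graph: "RHL n G \<Longrightarrow> simple_graph G"
proof (induction rule: RHL.induct)
  case RHL_oplus
  then show ?case by (intro simple_graph_oplus)
qed (simp_all add: isomorphic_def)

lemma RHL_robust:
  assumes "RHL n G" "3 \<le> n"
  shows "robust (n - 1) G"
  using assms(2,1)
proof (induction n arbitrary: G rule: dec_induct)
  case base
  then have "isomorphic G84 G" by (cases rule: RHL.cases) auto
  then show ?case using robust_G84 by simp
next
  case (step n)
  obtain G0 G1 \<phi> where G: "G = oplus \<phi> G0 G1" "RHL n G0" "RHL n G1"
    "verts G0 \<inter> verts G1 = {}" "bij_betw \<phi> (verts G0) (verts G1)"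
    using step.prems(1) step.hyps(1) by (rule RHL_Suc_cases)
  note * = robust_oplus[OF RHL_simple_graph[OF G(2)] RHL_simple_graph[OF G(3)] G(4,5)
      step.IH[OF G(2)] step.IH[OF G(3)]]
  have n: "2 \<le> n - 1" "Suc (n - 1) = n" using step.hyps by auto
  have "robust n G"
    unfolding robust_def
  proof (intro allI impI)
    fix U D
    assume "U \<subseteq> verts G" "D \<subseteq> edges G" "card U + card D \<le> n"
      "\<not> (card U = 1 \<and> card U + card D = n)"
    then show "indicator (verts G - U) \<in> edge_cone (edges G - D)"
      \<comment> \<open>The exception granted by \<open>robust n\<close> provides the second
        alternative in the last premise of \<open>robust_oplus\<close>, so the step from dimension 3
        to 4 is covered too.\<close>
      using *[OF n(1), of U D] unfolding G(1)[symmetric] n(2) by blast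
  qed
  then show ?case by simp
qed

text \<open>The halves are robust with parameter \<open>n - 2\<close>, which is at least 3 as
  \<open>n \<ge> 5\<close>. So \<open>robust_oplus\<close> covers all deletions of total size at
  most \<open>n - 1\<close>, whereas \<open>RHL_robust\<close> for \<open>G\<close> itself would
  leave an exception.\<close>

lemma RHL_tolerates_deletion:
  assumes "5 \<le> n" "RHL n G" "U \<subseteq> verts G" "D \<subseteq> edges G" "card U + card D < n"
  shows "\<exists>g. fractional_perfect_matching (delete G U D) g"
proof -
  have "RHL (Suc (n - 1)) G" "3 \<le> n - 1" using assms(1,2) by simp_all
  then obtain G0 G1 \<phi> where G: "G = oplus \<phi> G0 G1" "RHL (n - 1) G0" "RHL (n - 1) G1"
    "verts G0 \<inter> verts G1 = {}" "bij_betw \<phi> (verts G0) (verts G1)"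
    by (rule RHL_Suc_cases)
  have rob: "robust (n - 1 - 1) G0" "robust (n - 1 - 1) G1"
    using assms(1) by (intro RHL_robust G(2,3); simp)+
  have "2 \<le> n - 1 - 1" "card U + card D \<le> Suc (n - 1 - 1)" "3 \<le> n - 1 - 1"
    using assms(1,5) by auto
  then have "indicator (verts G - U) \<in> edge_cone (edges G - D)"
    using robust_oplus[OF RHL_simple_graph[OF G(2)] RHL_simple_graph[OF G(3)] G(4,5) rob, of U D]
      assms(3,4) unfolding G(1)[symmetric] by blast
  then show ?thesis by (rule fractional_perfect_matching_delete[OF RHL_simple_graph[OF assms(2)]])
qed

section \<open>Upper bound: regularity and isolating a vertex\<close>

text \<open>\<open>G84\<close> is cubic, and each use of \<open>oplus\<close> gives every vertex
  exactly one new edge, the one to its partner.\<close>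

lemma RHL_regular:
  assumes "RHL n G" "3 \<le> n" "v \<in> verts G"
  shows "card {e \<in> edges G. v \<in> e} = n"
  using assms(2,1,3)
proof (induction n arbitrary: G v rule: dec_induct)
  case base
  then have "isomorphic G84 G" by (cases rule: RHL.cases) auto
  with base obtain x1 x2 x3 x4 x5 x6 x7 where "mobius_ladder G v x1 x2 x3 x4 x5 x6 x7"
    by (elim isomorphic_G84_mobius_ladder)
  then have d: "distinct [v, x1, x2, x3, x4, x5, x6, x7]"
    and E: "edges G = {{v, x1}, {x2, x3}, {x4, x5}, {x6, x7}, {x1, x2}, {x3, x4}, {x5, x6},
        {x7, v}, {v, x4}, {x1, x5}, {x2, x6}, {x3, x7}}"
    unfolding mobius_ladder_def by (simp_all only:)
  have "{e \<in> edges G. v \<in> e} = {{v, x1}, {x7, v}, {v, x4}}"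
    unfolding E using d by (intro equalityI subsetI) auto
  also have "card \<dots> = 3"
    using d by (auto simp: card_insert_if doubleton_eq_iff)
  finally show ?case .
next
  case (step n)
  obtain G0 G1 \<phi> where G: "G = oplus \<phi> G0 G1" "RHL n G0" "RHL n G1"
    "verts G0 \<inter> verts G1 = {}" "bij_betw \<phi> (verts G0) (verts G1)"
    using step.prems(1) step.hyps(1) by (rule RHL_Suc_cases)
  \<comment> \<open>Stated for arbitrary halves and bijection, so that it also serves vertices of
    \<open>G1\<close> after swapping the halves.\<close>
  have deg: "card {e \<in> edges (oplus \<phi> H0 H1). v \<in> e} = Suc n"
    if H: "RHL n H0" "RHL n H1" "verts H0 \<inter> verts H1 = {}" "bij_betw \<phi> (verts H0) (verts H1)"
      and v: "v \<in> verts H0" for H0 H1 :: "'a graph" and \<phi>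
  proof -
    have s: "simple_graph H0" "simple_graph H1" using H by (auto intro: RHL_simple_graph)
    have \<phi>: "\<phi> x \<in> verts H1" if "x \<in> verts H0" for x using that H(4) by (auto simp: bij_betw_def)
    have "{e \<in> edges (oplus \<phi> H0 H1). v \<in> e} = insert {v, \<phi> v} {e \<in> edges H0. v \<in> e}"
    proof -
      have "{e \<in> edges H1. v \<in> e} = {}"
        using s(2) v H(3) by (auto simp: simple_graph_def)
      moreover have "{e \<in> {{x, \<phi> x} | x. x \<in> verts H0}. v \<in> e} = {{v, \<phi> v}}"
      proof (intro equalityI subsetI)
        fix e assume "e \<in> {e \<in> {{x, \<phi> x} | x. x \<in> verts H0}. v \<in> e}"
        then obtain x where x: "e = {x, \<phi> x}" "x \<in> verts H0" "v \<in> e" by blast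
        moreover have "v \<noteq> \<phi> x" using \<phi>[OF x(2)] v H(3) by auto
        ultimately show "e \<in> {{v, \<phi> v}}" by simp
      qed (use v in auto)
      moreover have "{e \<in> edges (oplus \<phi> H0 H1). v \<in> e} = {e \<in> edges H0. v \<in> e} \<union>
          {e \<in> edges H1. v \<in> e} \<union> {e \<in> {{x, \<phi> x} | x. x \<in> verts H0}. v \<in> e}"
        unfolding oplus_def graph.sel by blast
      ultimately show ?thesis by (simp only: Un_empty_right Un_insert_right)
    qed
    moreover have "{v, \<phi> v} \<notin> edges H0"
      using s(1) \<phi>[OF v] H(3) unfolding simple_graph_def by blast
    ultimately show ?thesis
      using step.IH[OF H(1) v] simple_graph_finite_edges[OF s(1)] by simp
  qed
  show ?case
  proof (cases "v \<in> verts G0")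
    case True
    then show ?thesis using deg[OF G(2,3,4,5)] G(1) by simp
  next
    case False
    then have "v \<in> verts G1" using step.prems G(1) by (simp add: oplus_def)
    moreover have "verts G1 \<inter> verts G0 = {}" using G(4) by blast
    ultimately show ?thesis
      unfolding G(1) oplus_commute[OF G(5)] using G(2,3,5)
      by (intro deg bij_betw_inv_into)
  qed
qed

lemma RHL_verts_nonempty:
  assumes "RHL n G"
  shows "verts G \<noteq> {}"
  using assms
proof (induction rule: RHL.induct)
  case RHL_0
  then show ?case by (rule isomorphic_verts_nonempty[where v = 0]) (simp add: complete_graph_def)
next
  case RHL_1
  then show ?case by (rule isomorphic_verts_nonempty[where v = 0]) (simp add: complete_graph_def)
next
  case RHL_2
  then show ?case by (rule isomorphic_verts_nonempty[where v = 0]) (simp add: C4_def)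
next
  case RHL_3
  then show ?case by (rule isomorphic_verts_nonempty[where v = 0]) (simp add: G84_def)
next
  case RHL_oplus
  then show ?case by (simp add: oplus_def)
qed

text \<open>No edge is left at \<open>v\<close>, so the sum there is empty and equals 0 instead of
  1.\<close>

lemma isolated_vertex_no_fractional_perfect_matching:
  assumes "v \<in> verts G - U"
  shows "\<not> fractional_perfect_matching (delete G U {e \<in> edges G. v \<in> e}) g"
proof
  let ?H = "delete G U {e \<in> edges G. v \<in> e}"
  assume "fractional_perfect_matching ?H g"
  moreover have "v \<in> verts ?H"
    using assms by (simp add: delete_def)
  ultimately have "(\<Sum>e\<in>{e \<in> edges ?H. v \<in> e}. g e) = 1"
    unfolding fractional_perfect_matching_def by (elim conjE bspec)
  moreover have "{e \<in> edges ?H. v \<in> e} = {}"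
    by (auto simp: delete_def)
  ultimately show False by (simp only: sum.empty zero_neq_one)
qed

theorem theorem4p4:
  fixes n :: nat and G :: "'a graph"
  assumes "n \<ge> 5" and "RHL n G"
  shows "fsmp G = n \<and> fmp G = n"
proof
  obtain v where v: "v \<in> verts G" using RHL_verts_nonempty[OF assms(2)] by blast
  \<comment> \<open>Deleting the \<open>n\<close> edges at one vertex attains both minima.\<close>
  define S where "S = {e \<in> edges G. v \<in> e}"
  have S: "S \<subseteq> edges G" "finite S" "card S = n"
    using RHL_regular[OF assms(2) _ v] assms(1) simple_graph_finite_edges[OF RHL_simple_graph[OF assms(2)]]
    by (auto simp: S_def)
  have noS: "\<nexists>g. fractional_perfect_matching (delete G {} S) g"
    unfolding S_def using isolated_vertex_no_fractional_perfect_matching[of v G "{}"] v by simp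
  show "fmp G = n"
    unfolding fmp_def
  proof (rule Least_equality)
    show "\<exists>F\<subseteq>edges G. finite F \<and> card F = n \<and> (\<nexists>g. fractional_perfect_matching (delete G {} F) g)"
      using S noS by blast
  next
    fix k
    assume "\<exists>F\<subseteq>edges G. finite F \<and> card F = k \<and> (\<nexists>g. fractional_perfect_matching (delete G {} F) g)"
    then obtain F where F: "F \<subseteq> edges G" "card F = k"
      "\<nexists>g. fractional_perfect_matching (delete G {} F) g" by blast
    show "n \<le> k"
    proof (rule ccontr)
      assume "\<not> n \<le> k"
      then show False using RHL_tolerates_deletion[OF assms, of "{}" F] F by simp
    qed
  qed
  show "fsmp G = n"
    unfolding fsmp_def
  proof (rule Least_equality)
    \<comment> \<open>The same edge set, tagged with \<open>Inr\<close>, serves as a mixed deletion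
      set without vertices.\<close>
    have "{v. Inl v \<in> (Inr ` S :: ('a + 'a set) set)} = {}" "{e. Inr e \<in> (Inr ` S :: ('a + 'a set) set)} = S"
      by auto
    then show "\<exists>F\<subseteq>verts G <+> edges G. finite F \<and> card F = n \<and>
        (\<nexists>g. fractional_perfect_matching (delete G {v. Inl v \<in> F} {e. Inr e \<in> F}) g)"
      using S noS by (intro exI[of _ "Inr ` S"]) (auto simp: card_image)
  next
    fix k
    assume "\<exists>F\<subseteq>verts G <+> edges G. finite F \<and> card F = k \<and>
        (\<nexists>g. fractional_perfect_matching (delete G {v. Inl v \<in> F} {e. Inr e \<in> F}) g)"
    then obtain F where F: "F \<subseteq> verts G <+> edges G" "finite F" "card F = k"
      "\<nexists>g. fractional_perfect_matching (delete G {v. Inl v \<in> F} {e. Inr e \<in> F}) g" by blast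
    define U where "U = {v. Inl v \<in> F}"
    define D where "D = {e. Inr e \<in> F}"
    have "F = U <+> D"
    proof (rule set_eqI)
      fix x show "x \<in> F \<longleftrightarrow> x \<in> U <+> D" by (cases x) (auto simp: U_def D_def)
    qed
    then have "card F = card U + card D"
      using F(2) by (simp add: card_Plus_conv_if)
    have "U \<subseteq> verts G" "D \<subseteq> edges G" using F(1) by (auto simp: U_def D_def)
    moreover have "\<nexists>g. fractional_perfect_matching (delete G U D) g"
      using F(4) by (simp only: U_def D_def not_False_eq_True)
    ultimately have "\<not> card U + card D < n"
      using RHL_tolerates_deletion[OF assms, of U D] by blast
    then show "n \<le> k" using \<open>card F = card U + card D\<close> F(3) by simp
  qed
qed

end
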